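(* For every integer $n\ge 0$, $$ \det \left[ \binom{3 (i +j) +1}{i+j} \right]_{0 \leq i,j \leq n} = \prod_{i=1}^n\frac{(6i+4)!\, (2i+1)!}{2\, (4 i+2)!\,(4i+3)!} \;\sum_{i=0}^n \frac{ n!\,(4n+3)!!\, (3n+i+2)! } {(3n+2)!\, i!\,(n-i)!\,(4n+2i+3)!!} $$ and $$ \det \left[ \binom{3 (i +j) +2}{i+j} \right]_{0 \leq i,j \leq n} = \prod_{i=1}^n\frac{(6i+4)!\, (2i+1)!}{2\, (4 i+2)!\,(4i+3)!}. $$
   Context: Here $(2r+1)!!=1\cdot 3\cdot 5\cdots(2r+1)$ is the double factorial. Empty products equal $1$. *)

theory Defs
  imports Complex_Main "Jordan_Normal_Form.Determinant"
begin

fun double_fact :: "nat \<Rightarrow> nat" where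
  "double_fact 0 = 1"
| "double_fact (Suc 0) = 1"
| "double_fact (Suc (Suc m)) = Suc (Suc m) * double_fact m"

lemma double_fact_odd: "double_fact (2 * r + 1) = (\<Prod>k\<le>r. 2 * k + 1)"
  by (induction r) simp_all

end

theory Submission
  imports Defs "HOL-Computational_Algebra.Polynomial_FPS"
begin

text \<open>
  Let \<open>x = \<epsilon>\<^sup>2(1 - \<epsilon>)\<close>, and let \<open>\<epsilon>(x) = 1 - x - \<dots>\<close> be the power series solution of this equation
  with \<open>\<epsilon>(0) = 1\<close>. By Lagrange inversion the numbers \<open>(3m + r choose m)\<close> are the coefficients of
  \<open>1 / s\<close> with \<open>s = \<epsilon>\<^sup>r(3\<epsilon> - 2)\<close>, algebraic of degree 3 over \<open>\<rat>(x)\<close>. The quotient of consecutive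
  Hankel determinants is read off from a Pade approximation of this series, that is, from
  polynomials \<open>A(x)\<close> of degree at most \<open>n\<close> and \<open>M(x)\<close> of degree less than \<open>n\<close> such that \<open>A(x) + M(x) s\<close>
  vanishes to order \<open>2n\<close> at \<open>x = 0\<close> on the branch \<open>\<epsilon>(0) = 1\<close>.

  As an element of \<open>\<rat>[\<epsilon>]\<close>, such an expression has the form \<open>F = (1 - \<epsilon>)\<^sup>2\<^sup>n V(\<epsilon>)\<close> with \<open>V\<close> of degree
  at most \<open>n\<close>. Conversely, such an \<open>F\<close> is of the form \<open>A(x) + M(x) s\<close> exactly if its third component
  over \<open>\<rat>[x]\<close> vanishes. Residues at infinity express this by \<open>n\<close> linear conditions: for \<open>k < n\<close>, the
  coefficient of \<open>\<epsilon>\<^sup>2\<^sup>k\<^sup>+\<^sup>1\<close> in \<open>(1 - \<epsilon>)\<^sup>2\<^sup>n\<^sup>-\<^sup>k\<^sup>-\<^sup>1 g V\<close> is zero, where \<open>g = 3\<epsilon> - 1\<close> for \<open>r = 1\<close> and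
  \<open>g = 1 - \<epsilon>\<close> for \<open>r = 2\<close>. If \<open>V\<close> satisfies them, then \<open>V(0) H\<^sub>n = V(1) H\<^sub>n\<^sub>-\<^sub>1\<close> for the determinants \<open>H\<^sub>n\<close> of
  order \<open>n + 1\<close> (lemma \<open>hankel_ratio\<close>).

  For \<open>r = 2\<close> an explicit solution is \<open>w\<^sub>n = (\<Sum>i\<le>n. \<sigma>\<^sub>n\<^sub>i \<epsilon>\<^sup>n\<^sup>-\<^sup>i (1 - \<epsilon>)\<^sup>i)\<close>, where \<open>2\<^sup>i \<sigma>\<^sub>n\<^sub>i\<close> is the \<open>i\<close>-th term of
  the sum in the first evaluation. The conditions become a vanishing hypergeometric sum
  (lemma \<open>alt_sum_eq_0\<close>), which obeys a homogeneous recurrence of order one. As \<open>w\<^sub>n(0) = \<sigma>\<^sub>n\<^sub>n\<close> and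
  \<open>w\<^sub>n(1) = 1\<close>, the determinant is the product of the numbers \<open>1 / \<sigma>\<^sub>i\<^sub>i\<close>.

  For \<open>r = 1\<close> the conditions on \<open>(3\<epsilon> - 1) V\<close> are satisfied by every combination of \<open>(1 - \<epsilon>) w\<^sub>n\<close> and
  \<open>\<epsilon>\<^sup>2 w\<^sub>n\<^sub>-\<^sub>1\<close>, and \<open>V\<close> comes from the one that vanishes at \<open>\<epsilon> = 1/3\<close>. Since \<open>3\<^sup>n w\<^sub>n(1/3)\<close> is the sum
  \<open>S\<^sub>n\<close> of the first evaluation, \<open>V(1) / V(0) = S\<^sub>n / (S\<^sub>n\<^sub>-\<^sub>1 \<sigma>\<^sub>n\<^sub>n)\<close>, and the quotients \<open>S\<^sub>n / S\<^sub>n\<^sub>-\<^sub>1\<close>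
  telescope.
\<close>

section \<open>A vanishing alternating sum\<close>

text \<open>The terms of the sum in the first evaluation.\<close>

definition term_coeff :: "nat \<Rightarrow> nat \<Rightarrow> rat" where
  "term_coeff n i = fact n * of_nat (double_fact (4 * n + 3)) * fact (3 * n + i + 2) /
     (fact (3 * n + 2) * fact i * fact (n - i) * of_nat (double_fact (4 * n + 2 * i + 3)))"

text \<open>The weights with which these terms enter the polynomials \<open>w\<^sub>n\<close>: the value of \<open>w\<^sub>n\<close> at
  \<open>1/3\<close>, multiplied by \<open>3\<^sup>n\<close>, is the unweighted sum.\<close>

definition sigma :: "nat \<Rightarrow> nat \<Rightarrow> rat" where
  "sigma n i = term_coeff n i / 2 ^ i"

lemma double_fact_pos: "double_fact m > 0"
  by (induction m rule: double_fact.induct) auto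

lemma double_fact_Suc_mult: "double_fact (Suc m) * double_fact m = fact (Suc m)"
proof (induction m)
  case (Suc m)
  have "double_fact (Suc (Suc m)) * double_fact (Suc m)
      = Suc (Suc m) * (double_fact (Suc m) * double_fact m)"
    by (simp only: double_fact.simps mult_ac)
  then show ?case
    by (simp add: Suc)
qed simp

lemma double_fact_even: "double_fact (2 * m) = 2 ^ m * fact m"
  by (induction m) (simp_all add: algebra_simps)

lemma double_fact_odd_fact:
  "of_nat (double_fact (2 * m + 1)) * (2 ^ m * fact m) = (fact (2 * m + 1) :: rat)"
proof -
  have "double_fact (2 * m + 1) * (2 ^ m * fact m) = fact (2 * m + 1)"
    using double_fact_Suc_mult[of "2 * m"] by (simp only: double_fact_even Suc_eq_plus1)
  then have "of_nat (double_fact (2 * m + 1) * (2 ^ m * fact m)) = (of_nat (fact (2 * m + 1)) :: rat)"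
    by (simp only:)
  then show ?thesis
    by (simp only: of_nat_mult of_nat_power of_nat_fact of_nat_numeral)
qed

lemma sigma_0: "sigma n 0 = 1"
proof -
  have "double_fact (4 * n + 3) > 0"
    by (rule double_fact_pos)
  then show ?thesis
    by (simp add: sigma_def term_coeff_def)
qed

lemma sigma_pos: "sigma n i > 0"
  using double_fact_pos by (simp add: sigma_def term_coeff_def)

lemma sigma_Suc:
  assumes "i < n"
  shows "2 * of_nat (Suc i) * of_nat (4 * n + 2 * i + 5) * sigma n (Suc i)
       = of_nat (n - i) * of_nat (3 * n + i + 3) * sigma n i"
proof -
  obtain k where k: "n = Suc (i + k)"
    using assms less_imp_Suc_add by blast
  define D where "D = (of_nat (double_fact (4 * n + 2 * i + 3)) :: rat)"
  have D: "D > 0"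
    unfolding D_def using double_fact_pos by simp
  have D2: "of_nat (double_fact (4 * n + 2 * Suc i + 3)) = of_nat (4 * n + 2 * i + 5) * D"
  proof -
    have "4 * n + 2 * Suc i + 3 = Suc (Suc (4 * n + 2 * i + 3))" by simp
    then show ?thesis by (simp only: double_fact.simps D_def of_nat_mult[symmetric]) simp
  qed
  have f1: "fact (3 * n + Suc i + 2) = (of_nat (3 * n + i + 3) * fact (3 * n + i + 2) :: rat)"
    using fact_Suc[of "3 * n + i + 2", where ?'a = rat] by (simp add: add_ac)
  have f2: "fact (n - i) = (of_nat (n - i) * fact (n - Suc i) :: rat)"
    unfolding k by (simp add: fact_Suc)
  have f3: "fact (Suc i) = (of_nat (Suc i) * fact i :: rat)"
    by (rule fact_Suc)
  define E where "E = (fact n * of_nat (double_fact (4 * n + 3)) * fact (3 * n + i + 2) / fact (3 * n + 2) :: rat)"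
  have nz: "(of_nat (n - i) :: rat) \<noteq> 0" "(of_nat (Suc i) :: rat) \<noteq> 0"
      "(of_nat (4 * n + 2 * i + 5) :: rat) \<noteq> 0"
    using assms by (simp_all del: of_nat_Suc of_nat_add)
  have a: "sigma n i = E / (fact i * (of_nat (n - i) * fact (n - Suc i)) * D) / 2 ^ i"
    unfolding sigma_def term_coeff_def E_def D_def[symmetric] f2[symmetric] by simp
  have b: "sigma n (Suc i) = of_nat (3 * n + i + 3) * E /
      (of_nat (Suc i) * fact i * fact (n - Suc i) * (of_nat (4 * n + 2 * i + 5) * D)) / (2 * 2 ^ i)"
    unfolding sigma_def term_coeff_def E_def f1 f3 D2 by (simp add: mult.assoc)
  show ?thesis
    unfolding a b using nz D by (simp add: divide_simps del: of_nat_Suc of_nat_add)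
qed

lemma binomial_Suc_mult:
  "(of_nat N + 1 - of_nat m) * of_nat (Suc N choose m) = (of_nat N + 1) * (of_nat (N choose m) :: rat)"
proof (cases "m \<le> N")
  case True
  have "(Suc N - m) * (Suc N choose m) = Suc N * (N choose m)"
    using binomial_absorb_comp[of "Suc N" m] by simp
  then have "of_nat (Suc N - m) * of_nat (Suc N choose m) = (of_nat (Suc N) * of_nat (N choose m) :: rat)"
    by (simp only: of_nat_mult[symmetric])
  moreover have "(of_nat (Suc N - m) :: rat) = of_nat N + 1 - of_nat m"
    using True by (simp add: of_nat_diff)
  ultimately show ?thesis
    by simp
next
  case False
  then show ?thesis
    by (cases "m = Suc N") (simp_all add: binomial_eq_0)
qed

lemma Suc_times_binomial_Suc:
  "(of_nat m + 1) * of_nat (N choose Suc m) = (of_nat N - of_nat m) * (of_nat (N choose m) :: rat)"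
proof (cases "m \<le> N")
  case True
  have "Suc m * (N choose Suc m) = (N - m) * (N choose m)"
    using binomial_absorption[of m N] binomial_absorb_comp[of N m] by (cases N) auto
  then have "of_nat (Suc m) * of_nat (N choose Suc m) = (of_nat (N - m) * of_nat (N choose m) :: rat)"
    by (simp only: of_nat_mult[symmetric])
  then show ?thesis
    using True by (simp add: of_nat_diff add.commute)
qed (simp add: binomial_eq_0)

lemma binomial_step:
  "(of_nat m + 1) * (of_nat m + 2) * (of_nat m + 3) * of_nat (Suc N choose (m + 3))
   = (of_nat N + 1) * (of_nat N - of_nat m) * (of_nat N - of_nat m - 1) * (of_nat (N choose m) :: rat)"
proof -
  have 1: "(of_nat m + 3) * of_nat (Suc N choose (m + 3)) = (of_nat N + 1) * (of_nat (N choose (m + 2)) :: rat)"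
  proof -
    have "(m + 3) * (Suc N choose (m + 3)) = Suc N * (N choose (m + 2))"
      using Suc_times_binomial_eq[of N "m + 2"] by (simp add: eval_nat_numeral mult.commute)
    then have "of_nat (m + 3) * of_nat (Suc N choose (m + 3)) = (of_nat (Suc N) * of_nat (N choose (m + 2)) :: rat)"
      by (simp only: of_nat_mult[symmetric])
    then show ?thesis
      by (simp add: add.commute)
  qed
  have 2: "(of_nat m + 2) * of_nat (N choose (m + 2)) = (of_nat N - of_nat m - 1) * (of_nat (N choose (m + 1)) :: rat)"
    using Suc_times_binomial_Suc[of "Suc m" N] by (simp add: algebra_simps numeral_2_eq_2)
  have 3: "(of_nat m + 1) * of_nat (N choose (m + 1)) = (of_nat N - of_nat m) * (of_nat (N choose m) :: rat)"
    using Suc_times_binomial_Suc[of m N] by simp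
  have "(of_nat m + 1) * (of_nat m + 2) * (of_nat m + 3) * of_nat (Suc N choose (m + 3))
      = (of_nat m + 1) * (of_nat m + 2) * ((of_nat m + 3) * (of_nat (Suc N choose (m + 3)) :: rat))"
    by (simp only: mult_ac)
  also have "\<dots> = (of_nat N + 1) * (of_nat m + 1) * ((of_nat m + 2) * of_nat (N choose (m + 2)))"
    unfolding 1 by (simp only: mult_ac)
  also have "\<dots> = (of_nat N + 1) * (of_nat N - of_nat m - 1) * ((of_nat m + 1) * of_nat (N choose (m + 1)))"
    unfolding 2 by (simp only: mult_ac)
  finally show ?thesis
    unfolding 3 by (simp only: mult_ac)
qed

text \<open>Up to sign, the coefficient of \<open>\<epsilon>\<^sup>2\<^sup>k\<^sup>+\<^sup>1\<close> in \<open>(1 - \<epsilon>)\<^sup>2\<^sup>n\<^sup>-\<^sup>k w\<^sub>n(\<epsilon>)\<close>, where \<open>j = n - k\<close>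
  and \<open>w\<^sub>n\<close> is the polynomial \<open>pade_poly n\<close> below.\<close>

definition alt_sum :: "nat \<Rightarrow> nat \<Rightarrow> rat" where
  "alt_sum n j = (\<Sum>i\<le>n. (-1) ^ i * sigma n i * of_nat ((n + j + i) choose (3 * j - 1)))"

text \<open>The left-hand side minus the right-hand side, before summation over \<open>i\<close>, is a difference
  \<open>G (i + 1) - G i\<close> with \<open>G i\<close> a polynomial multiple of the summand for \<open>j\<close>, cut off beyond \<open>n\<close>; the function \<open>G\<close> comes
  from creative telescoping (Zeilberger's algorithm) in \<open>j\<close>.\<close>

lemma alt_sum_rec:
  assumes "j \<ge> 1"
  shows "- 3 * (3 * of_nat j) * (3 * of_nat j + 1) * (3 * of_nat j + 2) * alt_sum n (Suc j)
       = 6 * of_nat j * (of_nat n + of_nat j + 1) * (2 * of_nat n - 2 * of_nat j + 1) * alt_sum n j"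
    (is "?b * _ = ?a * _")
proof -
  define m where "m = 3 * j - 1"
  have m: "(of_nat m :: rat) = 3 * of_nat j - 1"
    using assms unfolding m_def by (simp add: of_nat_diff)
  define t where "t = (\<lambda>i. (-1) ^ i * sigma n i * of_nat ((n + j + i) choose m))"
  define t' where "t' = (\<lambda>i. (-1) ^ i * sigma n i * of_nat ((n + Suc j + i) choose (3 * Suc j - 1)))"
  define x where "x = (\<lambda>i. of_nat n + of_nat i - 2 * of_nat j + 1 :: rat)"
  define G where "G = (\<lambda>i. if i \<le> n then 2 * of_nat i * (4 * of_nat n + 3 + 2 * of_nat i) * x i * t i else 0)"
  have G_Suc: "G (Suc i) = - (of_nat n - of_nat i) * (3 * of_nat n + 3 + of_nat i) *
      (of_nat n + of_nat j + of_nat i + 1) * t i" if "i \<le> n" for i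
  proof (cases "i < n")
    case True
    have s: "2 * (of_nat i + 1) * (4 * of_nat n + 2 * of_nat i + 5) * sigma n (Suc i)
       = (of_nat n - of_nat i) * (3 * of_nat n + of_nat i + 3) * sigma n i"
      using sigma_Suc[OF True] True by (simp add: of_nat_diff add_ac)
    have b: "x (Suc i) * of_nat (Suc (n + j + i) choose m)
        = (of_nat n + of_nat j + of_nat i + 1) * (of_nat ((n + j + i) choose m) :: rat)"
      using binomial_Suc_mult[of "n + j + i" m] by (simp add: m x_def algebra_simps)
    have "G (Suc i) = - ((-1) ^ i) * (2 * (of_nat i + 1) * (4 * of_nat n + 2 * of_nat i + 5) * sigma n (Suc i))
         * (x (Suc i) * of_nat (Suc (n + j + i) choose m))"
      using True by (simp add: G_def t_def algebra_simps)
    then show ?thesis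
      unfolding s b t_def by (simp only: mult_ac add_ac minus_mult_left[symmetric] minus_mult_right[symmetric])
  next
    case False
    then show ?thesis using that by (simp add: G_def)
  qed
  \<comment> \<open>\<open>x i\<close> is \<open>N - m\<close> for the binomial coefficient \<open>N choose m\<close> in \<open>t i\<close>; as a rational it needs no condition \<open>m \<le> N\<close>.\<close>
  have step: "?b * t' i - ?a * t i = G (Suc i) - G i" if "i \<le> n" for i
  proof -
    define c where "c = (-1) ^ i * sigma n i"
    have "3 * Suc j - 1 = m + 3"
      using assms by (simp add: m_def)
    then have "3 * of_nat j * (3 * of_nat j + 1) * (3 * of_nat j + 2) * of_nat ((n + Suc j + i) choose (3 * Suc j - 1))
      = (of_nat n + of_nat j + of_nat i + 1) * x i * (x i - 1) * (of_nat ((n + j + i) choose m) :: rat)"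
      using binomial_step[of m "n + j + i"] by (simp add: m x_def algebra_simps)
    moreover have "?b * t' i = - 3 * c * (3 * of_nat j * (3 * of_nat j + 1) * (3 * of_nat j + 2)
        * of_nat ((n + Suc j + i) choose (3 * Suc j - 1)))"
      unfolding t'_def c_def by (simp only: mult_ac)
    ultimately have "?b * t' i = - 3 * (of_nat n + of_nat j + of_nat i + 1) * x i * (x i - 1) * t i"
      unfolding t_def c_def by (simp only: mult_ac)
    moreover have "G i = 2 * of_nat i * (4 * of_nat n + 3 + 2 * of_nat i) * x i * t i"
      using that by (simp add: G_def)
    ultimately show ?thesis
      unfolding G_Suc[OF that] x_def by (simp add: algebra_simps)
  qed
  have "?b * alt_sum n (Suc j) - ?a * alt_sum n j = (\<Sum>i\<le>n. ?b * t' i - ?a * t i)"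
    by (simp only: alt_sum_def t_def t'_def m_def sum_subtractf sum_distrib_left)
  also have "\<dots> = (\<Sum>i<Suc n. G (Suc i) - G i)"
    unfolding lessThan_Suc_atMost by (rule sum.cong) (simp_all only: atMost_iff step)
  also have "\<dots> = 0"
    unfolding sum_lessThan_telescope by (simp add: G_def)
  finally show ?thesis
    by simp
qed

text \<open>All binomial coefficients vanish for \<open>j = n + 1\<close>, and the recurrence carries this down to
  \<open>j = 1\<close>: the factor \<open>2 n - 2 j + 1\<close> is odd, hence nonzero.\<close>

lemma alt_sum_eq_0:
  assumes "1 \<le> j" "j \<le> n + 1"
  shows "alt_sum n j = 0"
  using assms(2,1)
proof (induction j rule: inc_induct)
  case base
  show ?case
    unfolding alt_sum_def by (intro sum.neutral ballI) (simp add: binomial_eq_0)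
next
  case (step j)
  have "(2 * of_nat n - 2 * of_nat j + 1 :: rat) = of_int (2 * int n - 2 * int j + 1)"
    by simp
  also have "\<dots> \<noteq> 0"
    unfolding of_int_eq_0_iff by presburger
  finally have "(2 * of_nat n - 2 * of_nat j + 1 :: rat) \<noteq> 0" .
  moreover have "(of_nat n + of_nat j + 1 :: rat) \<noteq> 0"
    by (simp add: add_nonneg_pos less_imp_neq[symmetric])
  moreover have "(of_nat j :: rat) \<noteq> 0"
    using step by simp
  moreover have "alt_sum n (Suc j) = 0"
    using step by simp
  ultimately show ?case
    using alt_sum_rec[OF \<open>1 \<le> j\<close>, of n] by (simp only: mult_zero_right mult_eq_0_iff) simp
qed

section \<open>The ring of polynomials over a cubic polynomial\<close>

text \<open>The variable \<open>\<epsilon>\<close>, the element \<open>1 - \<epsilon>\<close>, and \<open>x = \<epsilon>\<^sup>2(1 - \<epsilon>)\<close>, all in \<open>\<rat>[\<epsilon>]\<close>. The ring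
  \<open>\<rat>[x]\<close> sits in \<open>\<rat>[\<epsilon>]\<close> through \<open>pcompose A cub\<close>.\<close>

definition eps :: "rat poly" where "eps = [:0, 1:]"
definition dlt :: "rat poly" where "dlt = [:1, -1:]"
definition cub :: "rat poly" where "cub = eps ^ 2 * dlt"

lemma cub_eq: "cub = [:0, 0, 1, -1:]"
  by (simp add: cub_def eps_def dlt_def power2_eq_square)

lemma eps_nonzero [simp]: "eps \<noteq> 0" and dlt_nonzero [simp]: "dlt \<noteq> 0" and cub_nonzero [simp]: "cub \<noteq> 0"
  by (simp_all add: eps_def dlt_def cub_eq)

lemma degree_eps [simp]: "degree eps = 1" and degree_dlt [simp]: "degree dlt = 1"
  and degree_cub [simp]: "degree cub = 3"
  by (simp_all add: eps_def dlt_def cub_eq)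

lemma poly_eps [simp]: "poly eps a = a" and poly_dlt [simp]: "poly dlt a = 1 - a"
  by (simp_all add: eps_def dlt_def)

lemma coeff_eps_power_mult: "coeff (eps ^ a * P) k = (if k < a then 0 else coeff P (k - a))"
proof -
  have "eps ^ a = monom 1 a"
    by (simp add: eps_def monom_altdef)
  then show ?thesis
    by (simp add: coeff_monom_mult)
qed

lemma coeff_dlt_power: "coeff (dlt ^ N) k = (-1) ^ k * of_nat (N choose k)"
proof (cases "k \<le> N")
  case True
  then show ?thesis
    by (simp add: dlt_def coeff_linear_poly_power)
next
  case False
  moreover have "degree (dlt ^ N) = N"
    by (simp add: degree_power_eq)
  ultimately show ?thesis
    by (simp add: coeff_eq_0 binomial_eq_0)
qed

text \<open>The polynomial \<open>w\<^sub>n\<close>, written in the homogeneous basis \<open>\<epsilon>\<^sup>n\<^sup>-\<^sup>i(1 - \<epsilon>)\<^sup>i\<close>.\<close>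

definition pade_poly :: "nat \<Rightarrow> rat poly" where
  "pade_poly n = (\<Sum>i\<le>n. smult (sigma n i) (eps ^ (n - i) * dlt ^ i))"

lemma degree_pade_poly: "degree (pade_poly n) \<le> n"
  unfolding pade_poly_def
proof (rule degree_sum_le)
  fix i assume "i \<in> {..n}"
  then have "degree (eps ^ (n - i) * dlt ^ i) = n"
    by (simp add: degree_mult_eq degree_power_eq)
  then show "degree (smult (sigma n i) (eps ^ (n - i) * dlt ^ i)) \<le> n"
    using degree_smult_le[of "sigma n i" "eps ^ (n - i) * dlt ^ i"] by simp
qed simp

lemma poly_pade_poly: "poly (pade_poly n) a = (\<Sum>i\<le>n. sigma n i * (a ^ (n - i) * (1 - a) ^ i))"
  by (simp add: pade_poly_def poly_sum poly_power)

lemma poly_pade_poly_0: "poly (pade_poly n) 0 = sigma n n"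
proof -
  have "poly (pade_poly n) 0 = (\<Sum>i\<le>n. if i = n then sigma n n else 0)"
    unfolding poly_pade_poly by (rule sum.cong) (auto simp: power_0_left)
  then show ?thesis by simp
qed

lemma poly_pade_poly_1: "poly (pade_poly n) 1 = 1"
proof -
  have "poly (pade_poly n) 1 = (\<Sum>i\<le>n. if i = 0 then sigma n 0 else 0)"
    unfolding poly_pade_poly by (rule sum.cong) (auto simp: power_0_left)
  then show ?thesis by (simp add: sigma_0)
qed

lemma poly_pade_poly_third: "poly (pade_poly n) (1/3) = (\<Sum>i\<le>n. term_coeff n i) / 3 ^ n"
proof -
  have "sigma n i * ((1/3) ^ (n - i) * (1 - 1/3) ^ i) = term_coeff n i / 3 ^ n" if "i \<le> n" for i
  proof -
    have "(3::rat) ^ n = 3 ^ (n - i) * 3 ^ i"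
      using that by (simp flip: power_add)
    then show ?thesis
      by (simp add: sigma_def power_divide)
  qed
  then show ?thesis
    unfolding poly_pade_poly sum_divide_distrib by (intro sum.cong) auto
qed

lemma coeff_pade_poly_eq_0:
  assumes "k < n"
  shows "coeff (dlt ^ (2 * n - k) * pade_poly n) (2 * k + 1) = 0"
proof -
  define j where "j = n - k"
  have j: "1 \<le> j" "j \<le> n + 1" "n = k + j"
    using assms by (auto simp: j_def)
  have *: "coeff (eps ^ (n - i) * dlt ^ (n + j + i)) (2 * k + 1)
         = - ((-1) ^ n) * ((-1) ^ i * of_nat ((n + j + i) choose (3 * j - 1)))" if "i \<le> n" for i
  proof (cases "2 * k + 1 < n - i")
    case True
    then show ?thesis
      using j by (simp add: coeff_eps_power_mult binomial_eq_0)
  next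
    case False
    define l where "l = 2 * k + 1 - (n - i)"
    have l: "l + n = 2 * k + 1 + i" "l + (3 * j - 1) = n + j + i"
      using False that j by (auto simp: l_def)
    have "(-1) ^ (l + n) = ((-1) ^ (2 * k + 1 + i) :: rat)"
      by (simp only: l)
    then have "(-1 :: rat) ^ l * (-1) ^ n = - ((-1) ^ i)"
      by (simp add: power_add)
    then have sgn: "(-1 :: rat) ^ l = - ((-1) ^ n) * (-1) ^ i"
      by (cases "even n") (auto simp: minus_one_power_iff split: if_splits)
    have "(n + j + i) choose l = (n + j + i) choose (3 * j - 1)"
      using binomial_symmetric[of l "n + j + i"] by (simp flip: l(2))
    then show ?thesis
      using False by (simp only: coeff_eps_power_mult coeff_dlt_power if_False sgn mult.assoc flip: l_def)
  qed
  have "2 * n - k = n + j"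
    using j by simp
  then have "coeff (dlt ^ (2 * n - k) * pade_poly n) (2 * k + 1)
      = (\<Sum>i\<le>n. sigma n i * coeff (eps ^ (n - i) * dlt ^ (n + j + i)) (2 * k + 1))"
    by (simp add: pade_poly_def sum_distrib_left coeff_sum power_add mult_ac)
  also have "\<dots> = - ((-1) ^ n) * alt_sum n j"
    unfolding alt_sum_def sum_distrib_left
  proof (rule sum.cong)
    fix i assume "i \<in> {..n}"
    then have "i \<le> n" by simp
    show "sigma n i * coeff (eps ^ (n - i) * dlt ^ (n + j + i)) (2 * k + 1)
        = - ((-1) ^ n) * ((-1) ^ i * sigma n i * of_nat ((n + j + i) choose (3 * j - 1)))"
      unfolding *[OF \<open>i \<le> n\<close>] by (simp only: mult_ac)
  qed simp
  finally show ?thesis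
    using alt_sum_eq_0[OF j(1,2)] by simp
qed

section \<open>Expansion at the simple zero of the cubic\<close>

text \<open>A polynomial in \<open>\<epsilon>\<close> as a power series in \<open>\<delta> = 1 - \<epsilon>\<close>.\<close>

definition expand :: "rat poly \<Rightarrow> rat fps" where
  "expand G = fps_of_poly (pcompose G dlt)"

abbreviation geo :: "rat fps" where "geo \<equiv> inverse (1 - fps_X)"

text \<open>Near \<open>\<delta> = 0\<close> the element \<open>x = (1 - \<delta>)\<^sup>2\<delta>\<close> is a local parameter. By Lagrange inversion
  the number defined here is the coefficient of \<open>x\<^sup>m\<close> in the expansion of
  \<open>G / (\<epsilon>\<^sup>r(3\<epsilon> - 2))\<close>; with \<open>G = 1\<close> it is the entry \<open>(3m + r choose m)\<close> of the matrix. Taking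
  the formula in \<open>\<delta>\<close> as the definition avoids composing power series.\<close>

definition x_coeff :: "nat \<Rightarrow> nat \<Rightarrow> rat poly \<Rightarrow> rat" where
  "x_coeff r m G = fps_nth (expand G * geo ^ (2 * m + r + 1)) m"

lemma expand_add: "expand (G + H) = expand G + expand H"
  and expand_mult: "expand (G * H) = expand G * expand H"
  and expand_power: "expand (G ^ k) = expand G ^ k"
  and expand_smult: "expand (smult c G) = fps_const c * expand G"
  and expand_1: "expand 1 = 1"
proof -
  show m: "expand (G * H) = expand G * expand H" for G H
    by (simp add: expand_def pcompose_mult fps_of_poly_mult)
  show one: "expand 1 = 1"
    by (simp add: expand_def pcompose_1)
  show "expand (G ^ k) = expand G ^ k"
    by (induction k) (simp_all add: m one)
qed (simp_all add: expand_def pcompose_add pcompose_smult fps_of_poly_add fps_of_poly_smult)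

lemma fps_of_poly_dlt: "fps_of_poly dlt = 1 - fps_X"
  by (simp add: dlt_def fps_of_poly_pCons fps_of_poly_const)

lemma expand_eps: "expand eps = 1 - fps_X"
  by (simp add: expand_def eps_def pcompose_pCons fps_of_poly_dlt)

lemma expand_dlt: "expand dlt = fps_X"
proof -
  have "pcompose dlt dlt = [:0, 1:]"
    by (simp add: dlt_def pcompose_pCons)
  then show ?thesis
    by (simp add: expand_def)
qed

lemma geo_cancel: "(1 - fps_X) ^ a * geo ^ (a + b) = geo ^ b"
proof -
  have "(1 - fps_X) * geo = 1"
    by (rule inverse_mult_eq_1') simp
  then have "(1 - fps_X) ^ a * geo ^ a = 1"
    by (simp flip: power_mult_distrib)
  then show ?thesis
    by (simp add: power_add flip: mult.assoc)
qed

lemma geo_nth: "fps_nth geo i = 1"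
proof -
  have "geo = inverse (inverse (Abs_fps (\<lambda>_. 1)))"
    by (simp only: fps_inverse_gp')
  also have "\<dots> = Abs_fps (\<lambda>_. 1)"
    by (rule fps_inverse_idempotent) simp
  finally show ?thesis
    by simp
qed

lemma geo_power_nth: "fps_nth (geo ^ Suc N) m = of_nat ((N + m) choose m)"
proof (induction N arbitrary: m)
  case 0
  then show ?case
    by (simp add: geo_nth)
next
  case (Suc N)
  have "fps_nth (geo ^ Suc (Suc N)) m = (\<Sum>i=0..m. fps_nth (geo ^ Suc N) i)"
    by (subst power_Suc2) (simp add: fps_mult_nth geo_nth del: power_Suc)
  also have "\<dots> = of_nat (\<Sum>i\<le>m. (N + i) choose i)"
    by (simp only: Suc atLeast0AtMost of_nat_sum)
  also have "(\<Sum>i\<le>m. (N + i) choose i) = (Suc N + m) choose m"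
    using sum_choose_lower[of N m] by simp
  finally show ?case .
qed

lemma x_coeff_add: "x_coeff r m (G + H) = x_coeff r m G + x_coeff r m H"
  by (simp add: x_coeff_def expand_add distrib_right)

lemma x_coeff_smult: "x_coeff r m (smult c G) = c * x_coeff r m G"
  by (simp add: x_coeff_def expand_smult mult.assoc)

lemma x_coeff_cub_0: "x_coeff r 0 (cub * G) = 0"
  by (simp add: x_coeff_def cub_def expand_mult expand_dlt)

lemma x_coeff_cub_Suc: "x_coeff r (Suc m) (cub * G) = x_coeff r m G"
proof -
  have "expand (cub * G) * geo ^ (2 * Suc m + r + 1)
      = fps_X * (expand G * ((1 - fps_X) ^ 2 * geo ^ (2 + (2 * m + r + 1))))"
    by (simp add: cub_def expand_mult expand_power expand_eps expand_dlt mult_ac)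
  then show ?thesis
    unfolding x_coeff_def geo_cancel by (simp only: fps_X_mult_nth) simp
qed

lemma x_coeff_1: "x_coeff r m 1 = of_nat ((3 * m + r) choose m)"
  using geo_power_nth[of "2 * m + r" m] by (simp add: x_coeff_def expand_1 add_ac)

lemma x_coeff_pcompose:
  "x_coeff r m (pcompose A cub * h) = (\<Sum>k\<le>m. coeff A k * x_coeff r (m - k) h)"
proof (induction A arbitrary: m)
  case 0
  have "x_coeff r m 0 = 0"
    using x_coeff_smult[of r m 0 0] by simp
  then show ?case by simp
next
  case (pCons a A)
  have e: "pcompose (pCons a A) cub * h = smult a h + cub * (pcompose A cub * h)"
    by (simp add: pcompose_pCons algebra_simps)
  show ?case
  proof (cases m)
    case 0
    then show ?thesis
      by (simp add: e x_coeff_add x_coeff_smult x_coeff_cub_0)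
  next
    case (Suc m')
    then show ?thesis
      unfolding e by (simp add: x_coeff_add x_coeff_smult x_coeff_cub_Suc pCons.IH sum.atMost_Suc_shift del: sum.atMost_Suc)
  qed
qed

text \<open>The element of \<open>\<rat>[\<epsilon>]\<close> that cancels the denominator in \<open>x_coeff\<close>; its quotient by that
  denominator is the constant \<open>1\<close>.\<close>

definition unit_gen :: "nat \<Rightarrow> rat poly" where
  "unit_gen r = eps ^ r * (smult 3 eps - [:2:])"

lemma x_coeff_unit_gen:
  assumes "m \<ge> 1"
  shows "x_coeff r m (unit_gen r) = 0"
proof -
  obtain m' where m': "m = Suc m'"
    using assms by (cases m) auto
  have "unit_gen r = smult 3 (eps ^ Suc r) + smult (-2) (eps ^ r)"
    by (simp add: unit_gen_def algebra_simps)
  then have "x_coeff r m (unit_gen r) = 3 * x_coeff r m (eps ^ Suc r) - 2 * x_coeff r m (eps ^ r)"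
    by (simp only: x_coeff_add x_coeff_smult)
  also have "x_coeff r m (eps ^ Suc r) = of_nat ((3 * m - 1) choose m)"
    using geo_cancel[of "Suc r" "Suc (2 * m - 1)"] geo_power_nth[of "2 * m - 1" m] m'
    by (simp add: x_coeff_def expand_power expand_eps add_ac del: power_Suc)
  also have "x_coeff r m (eps ^ r) = of_nat ((3 * m) choose m)"
    using geo_cancel[of r "Suc (2 * m)"] geo_power_nth[of "2 * m" m]
    by (simp add: x_coeff_def expand_power expand_eps add_ac del: power_Suc)
  finally have "x_coeff r m (unit_gen r) = 3 * of_nat ((3 * m - 1) choose m) - 2 * of_nat ((3 * m) choose m)" .
  moreover have "3 * ((3 * m - 1) choose m) = 2 * ((3 * m) choose m)"
  proof -
    have "(3 * m - m) * ((3 * m) choose m) = 3 * m * ((3 * m - 1) choose m)"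
      by (rule binomial_absorb_comp)
    then have "m * (2 * ((3 * m) choose m)) = m * (3 * ((3 * m - 1) choose m))"
      by auto
    then show ?thesis
      using assms by auto
  qed
  then have "(of_nat (3 * ((3 * m - 1) choose m)) :: rat) = of_nat (2 * ((3 * m) choose m))"
    by (simp only:)
  then have "(3 * of_nat ((3 * m - 1) choose m) :: rat) = 2 * of_nat ((3 * m) choose m)"
    by (simp only: of_nat_mult of_nat_numeral)
  ultimately show ?thesis
    by simp
qed

section \<open>Residues at infinity\<close>

text \<open>Up to sign, the residue at infinity of \<open>G d\<epsilon> / x\<^sup>k\<^sup>+\<^sup>1\<close>: dividing by \<open>x\<^sup>k\<^sup>+\<^sup>1\<close>, of degree
  \<open>3k + 3\<close>, only the coefficient of \<open>\<epsilon>\<^sup>3\<^sup>k\<^sup>+\<^sup>2\<close> in the remainder contributes.\<close>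

definition res_inf :: "nat \<Rightarrow> rat poly \<Rightarrow> rat" where
  "res_inf k G = coeff (G mod cub ^ Suc k) (3 * k + 2)"

lemma res_inf_add: "res_inf k (G + H) = res_inf k G + res_inf k H"
  by (simp add: res_inf_def poly_mod_add_left)

lemma res_inf_smult: "res_inf k (smult c G) = c * res_inf k G"
  by (simp add: res_inf_def mod_smult_left)

lemma res_inf_small:
  assumes "degree G < 3 * Suc k"
  shows "res_inf k G = coeff G (3 * k + 2)"
proof -
  have "degree (cub ^ Suc k) = 3 * Suc k"
    by (simp add: degree_power_eq del: power_Suc)
  then show ?thesis
    using assms by (simp add: res_inf_def mod_poly_less del: power_Suc)
qed

lemma res_inf_cub_0: "res_inf 0 (cub * G) = 0"
  by (simp add: res_inf_def)

lemma res_inf_cub_Suc: "res_inf (Suc k) (cub * G) = - res_inf k G"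
proof -
  define P where "P = G mod cub ^ Suc k"
  have "cub ^ Suc k \<noteq> 0"
    by simp
  then have "degree P < degree (cub ^ Suc k) \<or> P = 0"
    unfolding P_def using degree_mod_less by blast
  then have "coeff P (3 * k + 3) = 0"
    by (auto simp: degree_power_eq coeff_eq_0 simp del: power_Suc)
  moreover have "(cub * G) mod cub ^ Suc (Suc k) = cub * P"
    unfolding P_def by (simp only: mult_mod_right power_Suc)
  moreover have "coeff (cub * P) (3 * Suc k + 2) = coeff P (3 * k + 3) - coeff P (3 * k + 2)"
    by (simp add: cub_eq eval_nat_numeral)
  ultimately show ?thesis
    by (simp add: res_inf_def P_def)
qed

lemma res_inf_pcompose:
  assumes "degree h \<le> 4"
  shows "res_inf k (pcompose M cub * h) = (-1) ^ k * coeff M k * res_inf 0 h"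
proof (induction M arbitrary: k)
  case 0
  show ?case by (simp add: res_inf_def)
next
  case (pCons a M)
  have e: "pcompose (pCons a M) cub * h = smult a h + cub * (pcompose M cub * h)"
    by (simp add: pcompose_pCons algebra_simps)
  show ?case
  proof (cases k)
    case 0
    then show ?thesis
      by (simp add: e res_inf_add res_inf_smult res_inf_cub_0)
  next
    case (Suc k')
    then have "res_inf k h = 0"
      using assms by (subst res_inf_small) (auto intro: coeff_eq_0)
    with Suc show ?thesis
      unfolding e by (simp add: res_inf_add res_inf_smult res_inf_cub_Suc pCons.IH)
  qed
qed

lemma coeff_dlt_mult_top:
  assumes "degree Q \<le> d"
  shows "coeff (dlt ^ k * Q) (k + d) = (-1) ^ k * coeff Q d"
proof (induction k)
  case (Suc k)
  have "degree (dlt ^ k * Q) \<le> k + d"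
    using degree_mult_le[of "dlt ^ k" Q] assms by (simp add: degree_power_eq)
  then have "coeff (dlt ^ k * Q) (Suc (k + d)) = 0"
    by (intro coeff_eq_0) simp
  moreover have "coeff (dlt * (dlt ^ k * Q)) (Suc (k + d)) = coeff (dlt ^ k * Q) (Suc (k + d)) - coeff (dlt ^ k * Q) (k + d)"
    by (simp add: dlt_def)
  ultimately show ?case
    using Suc by (simp add: mult.assoc)
qed simp

text \<open>If the numerator is divisible by \<open>(1 - \<epsilon>)\<^sup>k\<^sup>+\<^sup>1\<close>, the only finite pole is \<open>\<epsilon> = 0\<close>, and the
  residue there is a single coefficient.\<close>

lemma res_inf_dlt_power:
  "res_inf k (dlt ^ Suc k * P) = (-1) ^ Suc k * coeff P (2 * k + 1)"
proof -
  define E where "E = eps ^ (2 * k + 2)"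
  have E: "E \<noteq> 0" "degree E = 2 * k + 2"
    by (simp_all add: E_def degree_power_eq del: power_Suc)
  have "degree (P mod E) < degree E \<or> P mod E = 0"
    using degree_mod_less[OF E(1)] by blast
  then have d: "degree (P mod E) \<le> 2 * k + 1"
    using E by auto
  have "coeff P (2 * k + 1) = coeff (E * (P div E) + P mod E) (2 * k + 1)"
    by simp
  then have c: "coeff (P mod E) (2 * k + 1) = coeff P (2 * k + 1)"
    unfolding coeff_add by (simp add: E_def coeff_eps_power_mult del: power_Suc)
  have "cub ^ Suc k = dlt ^ Suc k * E"
    by (simp only: cub_def E_def power_mult_distrib flip: power_mult) (simp add: mult.commute)
  then have "(dlt ^ Suc k * P) mod cub ^ Suc k = dlt ^ Suc k * (P mod E)"
    by (simp only: mult_mod_right)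
  moreover have "3 * k + 2 = Suc k + (2 * k + 1)"
    by simp
  ultimately show ?thesis
    by (simp only: res_inf_def coeff_dlt_mult_top[OF d] c)
qed

text \<open>A weight for which the residues of \<open>dual_wt r\<close> and \<open>dual_wt r * unit_gen r\<close> over \<open>x\<close> at
  infinity vanish, whereas that of \<open>dual_wt r * \<epsilon>\<close> does not. Pairing with it therefore detects the
  \<open>\<epsilon>\<close>-component of an element of \<open>\<rat>[\<epsilon>]\<close> relative to the \<open>\<rat>[x]\<close>-basis
  \<open>1\<close>, \<open>unit_gen r\<close>, \<open>\<epsilon>\<close>. This is a basis because \<open>unit_gen r\<close> is \<open>3\<epsilon>\<^sup>2 - 2\<epsilon>\<close> for \<open>r = 1\<close> and
  \<open>\<epsilon>\<^sup>2 - 3x\<close> for \<open>r = 2\<close>. The value for \<open>r\<close> other than 1 is meant for \<open>r = 2\<close>.\<close>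

definition dual_wt :: "nat \<Rightarrow> rat poly" where
  "dual_wt r = (if r = 1 then [:-1, 3:] else [:1, -1:])"

lemma dual_wt_props:
  assumes "r \<in> {1, 2}"
  shows "degree (dual_wt r) \<le> 4" "degree (dual_wt r * unit_gen r) \<le> 4" "degree (dual_wt r * eps) \<le> 4"
    and "res_inf 0 (dual_wt r) = 0" "res_inf 0 (dual_wt r * unit_gen r) = 0" "res_inf 0 (dual_wt r * eps) \<noteq> 0"
proof -
  have s1: "dual_wt 1 * unit_gen 1 = cub * [:-9:] + smult 2 eps"
    by (simp add: dual_wt_def unit_gen_def cub_eq eps_def)
  have s2: "dual_wt 2 * unit_gen 2 = cub * [:-2, 3:]"
    by (simp add: dual_wt_def unit_gen_def cub_eq eps_def power2_eq_square)
  show "degree (dual_wt r) \<le> 4" "degree (dual_wt r * eps) \<le> 4"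
    by (simp_all add: dual_wt_def eps_def)
  show "degree (dual_wt r * unit_gen r) \<le> 4"
    using assms s1 s2 by (auto simp: cub_eq eps_def)
  show "res_inf 0 (dual_wt r) = 0" "res_inf 0 (dual_wt r * eps) \<noteq> 0"
    by (simp_all add: dual_wt_def res_inf_small eps_def numeral_2_eq_2)
  have "res_inf 0 eps = 0"
    by (simp add: res_inf_small eps_def numeral_2_eq_2)
  then show "res_inf 0 (dual_wt r * unit_gen r) = 0"
    using assms s1 s2 by (auto simp only: res_inf_add res_inf_smult res_inf_cub_0)
qed

text \<open>The degree bounds say that only \<open>A\<close> can reach degree \<open>n\<close>. The proof divides by \<open>x\<close> and rewrites
  the remainder in the basis; for \<open>r = 2\<close> this produces a further multiple of \<open>x\<close>.\<close>

lemma decomposition: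
  assumes "r \<in> {1, 2}" and "degree F \<le> 3 * n"
  shows "\<exists>A M B. F = pcompose A cub + pcompose M cub * unit_gen r + pcompose B cub * eps
    \<and> degree A \<le> n \<and> (\<forall>k\<ge>n. coeff M k = 0 \<and> coeff B k = 0)"
  using assms(2)
proof (induction n arbitrary: F)
  case 0
  then obtain c where "F = [:c:]"
    by (auto elim: degree_eq_zeroE)
  then show ?case
    by (intro exI[of _ "[:c:]"] exI[of _ 0]) simp
next
  case (Suc n)
  define G where "G = F div cub"
  define d where "d = F mod cub"
  have F: "F = cub * G + d"
    by (simp add: G_def d_def)
  have dd: "degree d \<le> 2"
    unfolding d_def using degree_mod_less[of cub F] by auto
  have "degree G \<le> 3 * n"
  proof (rule ccontr)
    assume G: "\<not> degree G \<le> 3 * n"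
    then have "degree (cub * G) = 3 + degree G"
      by (subst degree_mult_eq) auto
    with dd G have "degree F = 3 + degree G"
      unfolding F by (subst degree_add_eq_left) auto
    with G Suc.prems show False by simp
  qed
  from Suc.IH[OF this] obtain A M B where
    G: "G = pcompose A cub + pcompose M cub * unit_gen r + pcompose B cub * eps" and
    deg: "degree A \<le> n" "\<And>k. k \<ge> n \<Longrightarrow> coeff M k = 0" "\<And>k. k \<ge> n \<Longrightarrow> coeff B k = 0"
    by blast
  have d: "d = [:coeff d 0, coeff d 1, coeff d 2:]"
  proof (rule poly_eqI)
    fix k
    show "coeff d k = coeff [:coeff d 0, coeff d 1, coeff d 2:] k"
      using dd by (auto simp: coeff_pCons numeral_2_eq_2 split: nat.split intro: coeff_eq_0)
  qed
  have "\<exists>a m b a'. d = [:a:] + smult m (unit_gen r) + smult b eps + smult a' cub"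
  proof (cases "r = 1")
    case True
    have "d = [:coeff d 0:] + smult (coeff d 2 / 3) (unit_gen r)
        + smult (coeff d 1 + 2 * coeff d 2 / 3) eps + smult 0 cub"
      by (subst d) (simp add: True unit_gen_def eps_def)
    then show ?thesis by blast
  next
    case False
    then have "r = 2"
      using assms by simp
    have "d = [:coeff d 0:] + smult (coeff d 2) (unit_gen r)
        + smult (coeff d 1) eps + smult (3 * coeff d 2) cub"
      by (subst d) (simp add: \<open>r = 2\<close> unit_gen_def eps_def cub_eq power2_eq_square)
    then show ?thesis by blast
  qed
  then obtain a m b a' where d': "d = [:a:] + smult m (unit_gen r) + smult b eps + smult a' cub"
    by blast
  have "F = pcompose (pCons a (A + [:a':])) cub + pcompose (pCons m M) cub * unit_gen r
      + pcompose (pCons b B) cub * eps"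
    unfolding F G d' by (simp add: pcompose_pCons pcompose_add algebra_simps)
  moreover have "degree (pCons a (A + [:a':])) \<le> Suc n"
    using deg(1) degree_add_le[of A n "[:a':]"] by (simp add: degree_pCons_eq_if)
  moreover have "\<forall>k\<ge>Suc n. coeff (pCons m M) k = 0 \<and> coeff (pCons b B) k = 0"
    using deg by (auto simp: coeff_pCons split: nat.split)
  ultimately show ?case
    by blast
qed

section \<open>Hankel determinants and orthogonality\<close>

text \<open>The Hankel determinant of order \<open>n + 1\<close> of a sequence.\<close>

definition hankel :: "(nat \<Rightarrow> 'a :: comm_ring_1) \<Rightarrow> nat \<Rightarrow> 'a" where
  "hankel a n = det (mat (n + 1) (n + 1) (\<lambda>(i, j). a (i + j)))"

text \<open>The numbers \<open>q i\<close> are the coefficients of a polynomial of degree at most \<open>n + 1\<close> orthogonal to all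
  lower powers. Replacing the last column of the Hankel matrix by the combination of its columns
  with coefficients \<open>q i\<close> leaves one nonzero entry in that column.\<close>

lemma hankel_Suc:
  fixes a q :: "nat \<Rightarrow> 'a :: idom"
  assumes orth: "\<And>j. j \<le> n \<Longrightarrow> (\<Sum>i\<le>Suc n. q i * a (i + j)) = 0"
  shows "q (Suc n) * hankel a (Suc n) = (\<Sum>i\<le>Suc n. q i * a (i + Suc n)) * hankel a n"
proof -
  define N where "N = Suc (Suc n)"
  define H where "H = mat N N (\<lambda>(i, j). a (i + j))"
  define E where "E = mat N N (\<lambda>(i, j). if j = Suc n then q i else if i = j then 1 else 0)"
  define s where "s = (\<Sum>i\<le>Suc n. q i * a (i + Suc n))"
  have carr: "H \<in> carrier_mat N N" "E \<in> carrier_mat N N"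
    by (simp_all add: H_def E_def)
  have "upper_triangular E"
    by (auto simp: upper_triangular_def E_def N_def)
  then have "det E = (\<Prod>i = 0..<N. E $$ (i, i))"
    using det_upper_triangular[OF _ carr(2)] carr(2) by (simp add: prod_list_diag_prod)
  also have "\<dots> = q (Suc n)"
    by (simp add: E_def N_def)
  finally have detE: "det E = q (Suc n)" .
  define K where "K = H * E"
  have K: "K \<in> carrier_mat N N"
    using carr by (simp add: K_def)
  have last: "K $$ (i, Suc n) = (if i = Suc n then s else 0)" if "i < N" for i
  proof -
    have "K $$ (i, Suc n) = (\<Sum>k = 0..<N. a (i + k) * q k)"
      using that by (simp add: K_def H_def E_def N_def scalar_prod_def)
    also have "{0..<N} = {..Suc n}"
      by (auto simp: N_def)
    also have "(\<Sum>k\<le>Suc n. a (i + k) * q k) = (\<Sum>k\<le>Suc n. q k * a (k + i))"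
      by (simp only: mult.commute add.commute)
    finally show ?thesis
      using that orth[of i] by (auto simp: s_def N_def)
  qed
  have other: "K $$ (i, j) = a (i + j)" if "i < N" "j \<le> n" for i j
  proof -
    have "K $$ (i, j) = (\<Sum>k = 0..<N. a (i + k) * (if k = j then 1 else 0))"
      using that by (simp add: K_def H_def E_def N_def scalar_prod_def)
    also have "\<dots> = (\<Sum>k = 0..<N. if k = j then a (i + j) else 0)"
      by (rule sum.cong) auto
    also have "\<dots> = a (i + j)"
      using that by (simp add: N_def)
    finally show ?thesis .
  qed
  have "det K = (\<Sum>i<N. K $$ (i, Suc n) * cofactor K i (Suc n))"
    by (rule laplace_expansion_column) (use K in \<open>auto simp: N_def\<close>)
  also have "\<dots> = (\<Sum>i<N. if i = Suc n then s * cofactor K (Suc n) (Suc n) else 0)"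
    by (rule sum.cong) (auto simp: last)
  also have "\<dots> = s * cofactor K (Suc n) (Suc n)"
    by (simp add: N_def)
  also have "cofactor K (Suc n) (Suc n) = det (mat_delete K (Suc n) (Suc n))"
    by (simp add: cofactor_def)
  also have "mat_delete K (Suc n) (Suc n) = mat (n + 1) (n + 1) (\<lambda>(i, j). a (i + j))"
    using K by (intro eq_matI) (auto simp: mat_delete_def N_def other[unfolded N_def])
  finally have "det K = s * hankel a n"
    by (simp only: hankel_def)
  moreover have "det H = hankel a (Suc n)"
    by (simp add: hankel_def H_def N_def)
  ultimately show ?thesis
    using det_mult[OF carr] detE by (simp add: K_def s_def mult.commute)
qed

text \<open>The hypothesis makes the \<open>\<epsilon>\<close>-component of \<open>F = (1 - \<epsilon>)\<^sup>2\<^sup>n\<^sup>+\<^sup>2 V\<close> vanish, so that \<open>F\<close> is congruent to a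
  polynomial \<open>A(x)\<close> modulo \<open>\<rat>[x] unit_gen r\<close>. Then \<open>F\<close> and \<open>A(x)\<close> have the same \<open>x\<close>-coefficients
  from \<open>x\<^sup>n\<^sup>+\<^sup>1\<close> on. The coefficients of \<open>F\<close> vanish up to \<open>x\<^sup>2\<^sup>n\<^sup>+\<^sup>1\<close>, and that of \<open>x\<^sup>2\<^sup>n\<^sup>+\<^sup>2\<close> is \<open>V(1)\<close>;
  those of \<open>A(x)\<close> are the products of the Hankel matrix with the reversed coefficients of \<open>A\<close>.
  The leading orthogonal coefficient is \<open>A(0) = F(0) = V(0)\<close>, since \<open>\<epsilon> = 0\<close> is a zero of \<open>x\<close> and
  of \<open>unit_gen r\<close>.\<close>

lemma hankel_ratio:
  assumes r: "r \<in> {1, 2}" and deg: "degree V \<le> Suc n"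
    and V: "\<And>k. k \<le> n \<Longrightarrow> coeff (dlt ^ (2 * Suc n - Suc k) * (dual_wt r * V)) (2 * k + 1) = 0"
  defines "a \<equiv> \<lambda>m. of_nat ((3 * m + r) choose m)"
  shows "poly V 0 * hankel a (Suc n) = poly V 1 * hankel a n"
proof -
  define F where "F = dlt ^ (2 * Suc n) * V"
  have "degree F \<le> 2 * Suc n + degree V"
    unfolding F_def using degree_mult_le[of "dlt ^ (2 * Suc n)" V]
    by (simp add: degree_power_eq del: power_Suc)
  then have "degree F \<le> 3 * Suc n"
    using deg by simp
  from decomposition[OF r this] obtain A M B where
    F: "F = pcompose A cub + pcompose M cub * unit_gen r + pcompose B cub * eps" and
    A: "degree A \<le> Suc n" and M: "\<And>k. k \<ge> Suc n \<Longrightarrow> coeff M k = 0"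
    and B: "\<And>k. k \<ge> Suc n \<Longrightarrow> coeff B k = 0"
    by blast
  note g = dual_wt_props[OF r]
  have "coeff B k = 0" for k
  proof (cases "k \<le> n")
    case True
    have "dual_wt r * F = pcompose A cub * dual_wt r + pcompose M cub * (dual_wt r * unit_gen r)
        + pcompose B cub * (dual_wt r * eps)"
      by (simp add: F algebra_simps)
    then have "res_inf k (dual_wt r * F) = (-1) ^ k * coeff B k * res_inf 0 (dual_wt r * eps)"
      by (simp add: res_inf_add res_inf_pcompose g)
    moreover have "dual_wt r * F = dlt ^ Suc k * (dlt ^ (2 * Suc n - Suc k) * (dual_wt r * V))"
    proof -
      have "dlt ^ (2 * Suc n) = dlt ^ Suc k * dlt ^ (2 * Suc n - Suc k)"
        using True by (simp flip: power_add)
      then show ?thesis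
        by (simp add: F_def mult_ac)
    qed
    then have "res_inf k (dual_wt r * F) = 0"
      by (simp only: res_inf_dlt_power V[OF True] mult_zero_right)
    ultimately show ?thesis
      using g(6) by simp
  qed (simp add: B)
  then have B0: "B = 0"
    by (simp add: poly_eq_iff)
  \<comment> \<open>Multiplying a power series by \<open>A(x)\<close> reverses the order of the coefficients in the orthogonality relation.\<close>
  define q where "q = (\<lambda>i. coeff A (Suc n - i))"
  have sum_q: "(\<Sum>i\<le>Suc n. q i * a (i + j)) = x_coeff r (Suc n + j) F" for j
  proof -
    have "x_coeff r (Suc n + j) (pcompose M cub * unit_gen r) = 0"
      unfolding x_coeff_pcompose
    proof (rule sum.neutral, rule ballI)
      fix k
      show "coeff M k * x_coeff r (Suc n + j - k) (unit_gen r) = 0"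
        using M[of k] x_coeff_unit_gen[of "Suc n + j - k" r] by (cases "k \<le> n") simp_all
    qed
    then have "x_coeff r (Suc n + j) F = x_coeff r (Suc n + j) (pcompose A cub * 1)"
      by (simp add: F B0 x_coeff_add)
    also have "\<dots> = (\<Sum>k\<le>Suc n + j. coeff A k * a (Suc n + j - k))"
      by (simp only: x_coeff_pcompose x_coeff_1 a_def)
    also have "\<dots> = (\<Sum>k\<le>Suc n. coeff A k * a (Suc n + j - k))"
      using A by (intro sum.mono_neutral_right) (auto intro: coeff_eq_0)
    also have "\<dots> = (\<Sum>i\<le>Suc n. q i * a (i + j))"
      by (rule sum.reindex_bij_witness[of _ "\<lambda>i. Suc n - i" "\<lambda>i. Suc n - i"]) (auto simp: q_def)
    finally show ?thesis ..
  qed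
  have x_coeff_F: "x_coeff r (Suc n + j) F = (if j = Suc n then poly V 1 else 0)" if "j \<le> Suc n" for j
  proof -
    have "x_coeff r (Suc n + j) F
        = fps_nth (fps_X ^ (2 * Suc n) * (expand V * geo ^ (2 * (Suc n + j) + r + 1))) (Suc n + j)"
      by (simp only: x_coeff_def F_def expand_mult expand_power expand_dlt mult.assoc)
    also have "\<dots> = (if Suc n + j < 2 * Suc n then 0
        else fps_nth (expand V * geo ^ (2 * (Suc n + j) + r + 1)) (Suc n + j - 2 * Suc n))"
      by (rule fps_X_power_mult_nth)
    also have "\<dots> = (if j = Suc n then fps_nth (expand V * geo ^ (2 * (Suc n + j) + r + 1)) 0 else 0)"
      using that by auto
    also have "fps_nth (expand V * geo ^ (2 * (Suc n + j) + r + 1)) 0 = poly V 1"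
    proof -
      have "fps_nth (expand V) 0 = poly V 1"
        by (simp add: expand_def dlt_def poly_pcompose flip: poly_0_coeff_0)
      then show ?thesis
        by (simp only: fps_mult_nth_0 fps_nth_power_0 geo_nth power_one mult_1_right)
    qed
    finally show ?thesis .
  qed
  have "q (Suc n) * hankel a (Suc n) = (\<Sum>i\<le>Suc n. q i * a (i + Suc n)) * hankel a n"
    by (rule hankel_Suc) (simp only: sum_q x_coeff_F, simp)
  moreover have "(\<Sum>i\<le>Suc n. q i * a (i + Suc n)) = poly V 1"
    by (simp only: sum_q x_coeff_F) simp
  moreover have "q (Suc n) = poly V 0"
  proof -
    have "poly V 0 = poly F 0"
      by (simp add: F_def poly_power)
    also have "poly cub 0 = 0" "poly (unit_gen r) 0 = 0"
      using r by (auto simp: cub_def unit_gen_def poly_power)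
    then have "poly F 0 = poly A 0"
      by (simp add: F B0 poly_pcompose)
    finally show ?thesis
      by (simp add: q_def poly_0_coeff_0)
  qed
  ultimately show ?thesis
    by simp
qed

section \<open>The two evaluations\<close>

text \<open>The sum in the first evaluation.\<close>

definition term_sum :: "nat \<Rightarrow> rat" where "term_sum n = (\<Sum>i\<le>n. term_coeff n i)"

lemma term_sum_pos: "term_sum n > 0"
  unfolding term_sum_def
proof (rule sum_pos)
  show "term_coeff n i > 0" for i
    using sigma_pos[of n i] by (simp add: sigma_def zero_less_divide_iff)
qed auto

lemma hankel_2_Suc:
  defines "a \<equiv> \<lambda>m. of_nat ((3 * m + 2) choose m)"
  shows "sigma (Suc n) (Suc n) * hankel a (Suc n) = hankel a n"
proof -
  have "coeff (dlt ^ (2 * Suc n - Suc k) * (dual_wt 2 * pade_poly (Suc n))) (2 * k + 1) = 0" if "k \<le> n" for k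
  proof -
    have "dual_wt 2 = dlt"
      by (simp add: dual_wt_def dlt_def)
    moreover have "2 * Suc n - k = Suc (2 * Suc n - Suc k)"
      using that by simp
    ultimately have "dlt ^ (2 * Suc n - Suc k) * (dual_wt 2 * pade_poly (Suc n)) = dlt ^ (2 * Suc n - k) * pade_poly (Suc n)"
      by (simp only: power_Suc mult_ac)
    then show ?thesis
      using coeff_pade_poly_eq_0[of k "Suc n"] that by (simp only: less_Suc_eq_le)
  qed
  then show ?thesis
    using hankel_ratio[of 2 "pade_poly (Suc n)" n] by (simp add: degree_pade_poly poly_pade_poly_0 poly_pade_poly_1 a_def)
qed

text \<open>Here \<open>V\<close> has to satisfy the vanishing conditions after multiplication by \<open>3\<epsilon> - 1\<close>. Both
  \<open>(1 - \<epsilon>) w\<^sub>n\<^sub>+\<^sub>1\<close> and \<open>\<epsilon>\<^sup>2 w\<^sub>n\<close> satisfy the conditions themselves, and \<open>P\<close> is their combination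
  that vanishes at \<open>1/3\<close>.\<close>

lemma hankel_1_Suc:
  defines "a \<equiv> \<lambda>m. of_nat ((3 * m + 1) choose m)"
  shows "term_sum n * sigma (Suc n) (Suc n) * hankel a (Suc n) = term_sum (Suc n) * hankel a n"
proof -
  define P where "P = smult (term_sum n) (dlt * pade_poly (Suc n)) - smult (2 * term_sum (Suc n)) (eps ^ 2 * pade_poly n)"
  have "poly P (1/3) = 0"
    by (simp add: P_def poly_pade_poly_third poly_power term_sum_def power2_eq_square)
  then have "[:-(1/3), 1:] dvd P"
    by (simp only: poly_eq_0_iff_dvd)
  moreover have "[:1, -3:] = smult (-3) [:-(1/3), 1 :: rat:]"
    by simp
  ultimately have "[:1, -3:] dvd P"
    by (simp only: smult_dvd_iff) simp
  then obtain V where V: "P = [:1, -3:] * V"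
    by (elim dvdE)
  have "degree P \<le> Suc (Suc n)"
  proof -
    have "degree (dlt * pade_poly (Suc n)) \<le> Suc (Suc n)"
      using degree_mult_le[of dlt "pade_poly (Suc n)"] degree_pade_poly[of "Suc n"] by simp
    moreover have "degree (eps ^ 2 * pade_poly n) \<le> Suc (Suc n)"
      using degree_mult_le[of "eps ^ 2" "pade_poly n"] degree_pade_poly[of n] by (simp add: degree_power_eq)
    ultimately show ?thesis
      unfolding P_def by (intro degree_diff_le order.trans[OF degree_smult_le])
  qed
  then have deg: "degree V \<le> Suc n"
    unfolding V by (cases "V = 0") (simp_all add: degree_mult_eq del: mult_pCons_left)
  have "coeff (dlt ^ (2 * Suc n - Suc k) * (dual_wt 1 * V)) (2 * k + 1) = 0" if "k \<le> n" for k
  proof -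
    define l where "l = 2 * Suc n - Suc k"
    have l: "2 * Suc n - k = Suc l"
      using that by (simp add: l_def)
    have "dual_wt 1 = - [:1, -3:]"
      by (simp add: dual_wt_def)
    then have "dlt ^ l * (dual_wt 1 * V) = - (dlt ^ l * P)"
      unfolding V by (simp only: minus_mult_left minus_mult_right)
    also have "dlt ^ l * P = smult (term_sum n) (dlt ^ Suc l * pade_poly (Suc n))
        - smult (2 * term_sum (Suc n)) (eps ^ 2 * (dlt ^ l * pade_poly n))"
      by (simp add: P_def right_diff_distrib mult_ac)
    finally have e: "dlt ^ l * (dual_wt 1 * V) = smult (2 * term_sum (Suc n)) (eps ^ 2 * (dlt ^ l * pade_poly n))
        - smult (term_sum n) (dlt ^ Suc l * pade_poly (Suc n))"
      by simp
    have "coeff (dlt ^ Suc l * pade_poly (Suc n)) (2 * k + 1) = 0"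
      using coeff_pade_poly_eq_0[of k "Suc n"] that by (simp only: l)
    moreover have "coeff (eps ^ 2 * (dlt ^ l * pade_poly n)) (2 * k + 1) = 0"
    proof (cases k)
      case 0
      then show ?thesis
        by (simp add: coeff_eps_power_mult del: power2_eq_square)
    next
      case (Suc k')
      then have "l = 2 * n - k'"
        by (simp add: l_def)
      then show ?thesis
        using coeff_pade_poly_eq_0[of k' n] that Suc by (simp add: coeff_eps_power_mult)
    qed
    ultimately show ?thesis
      unfolding l_def[symmetric] e by simp
  qed
  then have "poly V 0 * hankel a (Suc n) = poly V 1 * hankel a n"
    unfolding a_def by (intro hankel_ratio deg) simp_all
  moreover have "poly V 0 = term_sum n * sigma (Suc n) (Suc n)"
    using arg_cong[OF V, of "\<lambda>p. poly p 0"] by (simp add: P_def poly_power poly_pade_poly_0)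
  moreover have "poly V 1 = term_sum (Suc n)"
    using arg_cong[OF V, of "\<lambda>p. poly p 1"] by (simp add: P_def poly_power poly_pade_poly_1)
  ultimately show ?thesis
    by simp
qed

lemma inverse_sigma:
  "1 / sigma n n = fact (6 * n + 4) * fact (2 * n + 1) / (2 * fact (4 * n + 2) * fact (4 * n + 3))"
proof -
  define x y :: rat where "x = of_nat (double_fact (4 * n + 3))" and "y = of_nat (double_fact (6 * n + 3))"
  have nz: "x > 0" "y > 0"
    using double_fact_pos by (simp_all add: x_def y_def)
  have x: "fact (4 * n + 3) = x * (2 ^ (2 * n + 1) * fact (2 * n + 1))"
    using double_fact_odd_fact[of "2 * n + 1"]
    by (simp only: x_def distrib_left mult.assoc[symmetric] add.assoc) simp
  have "Suc (6 * n + 3) = 6 * n + 4"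
    by simp
  have "double_fact (6 * n + 4) * double_fact (6 * n + 3) = fact (6 * n + 4)"
    using double_fact_Suc_mult[of "6 * n + 3"] \<open>Suc (6 * n + 3) = 6 * n + 4\<close> by (simp only:)
  moreover have "double_fact (6 * n + 4) = 2 ^ (3 * n + 2) * fact (3 * n + 2)"
    using double_fact_even[of "3 * n + 2"] by (simp only: distrib_left mult.assoc[symmetric]) simp
  ultimately have "of_nat (2 ^ (3 * n + 2) * fact (3 * n + 2) * double_fact (6 * n + 3)) = (of_nat (fact (6 * n + 4)) :: rat)"
    by (simp only:)
  then have y: "fact (6 * n + 4) = 2 ^ (3 * n + 2) * fact (3 * n + 2) * y"
    by (simp only: of_nat_mult of_nat_power of_nat_fact of_nat_numeral y_def)
  have "4 * n + 2 * n + 3 = 6 * n + 3" "3 * n + n + 2 = 4 * n + 2"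
    by simp_all
  then have sig: "sigma n n = x * fact (4 * n + 2) / (fact (3 * n + 2) * y) / 2 ^ n"
    by (simp only: sigma_def term_coeff_def x_def y_def) (simp del: fact_Suc)
  have "3 * n + 2 = Suc (n + (2 * n + 1))"
    by simp
  then have pow: "(2 :: rat) ^ (3 * n + 2) = 2 * (2 ^ n * 2 ^ (2 * n + 1))"
    by (simp only: power_Suc power_add)
  have cancel: "1 / (x * b / (c * y) / u) = 2 * (u * v) * c * y * d / (2 * b * (x * (v * d)))"
    if "b > 0" "c > 0" "d > 0" "u > 0" "v > 0" for b c d u v :: rat
    using that nz by (simp add: divide_simps)
  show ?thesis
    unfolding x y sig pow by (rule cancel) simp_all
qed

theorem corollary9:
  fixes n :: nat
  shows
    "det (mat (n + 1) (n + 1) (\<lambda>(i, j). of_nat ((3 * (i + j) + 1) choose (i + j)) :: rat)) =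
      (\<Prod>i = 1..n. fact (6 * i + 4) * fact (2 * i + 1) /
          (2 * fact (4 * i + 2) * fact (4 * i + 3))) *
      (\<Sum>i = 0..n. fact n * of_nat (double_fact (4 * n + 3)) * fact (3 * n + i + 2) /
          (fact (3 * n + 2) * fact i * fact (n - i) *
            of_nat (double_fact (4 * n + 2 * i + 3)))) \<and>
    det (mat (n + 1) (n + 1) (\<lambda>(i, j). of_nat ((3 * (i + j) + 2) choose (i + j)) :: rat)) =
      (\<Prod>i = 1..n. fact (6 * i + 4) * fact (2 * i + 1) /
          (2 * fact (4 * i + 2) * fact (4 * i + 3)))"
proof -
  define a :: "nat \<Rightarrow> nat \<Rightarrow> rat" where "a = (\<lambda>r m. of_nat ((3 * m + r) choose m))"
  define p :: "nat \<Rightarrow> rat" where "p = (\<lambda>n. \<Prod>i = 1..n. 1 / sigma i i)"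
  have p_Suc: "p (Suc k) * sigma (Suc k) (Suc k) = p k" for k
    using sigma_pos[of "Suc k" "Suc k"] by (simp add: p_def)
  have base: "hankel (a r) 0 = 1" for r
    by (simp add: hankel_def a_def det_def)
  have H2: "hankel (a 2) n = p n"
  proof (induction n)
    case 0
    show ?case by (simp add: base p_def)
  next
    case (Suc k)
    have "sigma (Suc k) (Suc k) * hankel (a 2) (Suc k) = sigma (Suc k) (Suc k) * p (Suc k)"
      using hankel_2_Suc[of k] p_Suc[of k] Suc by (simp add: a_def mult.commute)
    then show ?case
      using sigma_pos[of "Suc k" "Suc k"] by simp
  qed
  have H1: "hankel (a 1) n = p n * term_sum n"
  proof (induction n)
    case 0
    have "term_sum 0 = 1"
      using sigma_0[of 0] by (simp add: term_sum_def sigma_def)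
    then show ?case by (simp add: base p_def)
  next
    case (Suc k)
    have "(term_sum k * sigma (Suc k) (Suc k)) * hankel (a 1) (Suc k) = term_sum (Suc k) * (p k * term_sum k)"
      using hankel_1_Suc[of k] Suc by (simp add: a_def)
    also have "\<dots> = (term_sum k * sigma (Suc k) (Suc k)) * (p (Suc k) * term_sum (Suc k))"
      unfolding p_Suc[of k, symmetric] by (simp only: mult_ac)
    finally show ?case
      using sigma_pos[of "Suc k" "Suc k"] term_sum_pos[of k] by simp
  qed
  show ?thesis
    using H1 H2 unfolding hankel_def a_def p_def term_sum_def term_coeff_def inverse_sigma atLeast0AtMost
    by blast
qed

end
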